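(* Let $N\ge4$ and $q>q_S:=\frac{N+1}{N-3}$. Let $\varepsilon_0>0$ be a number with $\frac{N-1}{q-1}-\varepsilon_0>0$ such that for every $a$ with $\frac{N-1}{q-1}-\varepsilon_0<a<\frac{N-1}{q-1}$ the problem $$V\in C^2(\mathbb{S}^{N-1}),\qquad -\Delta_\theta V+aV=V^q,\quad V>0\quad\text{on }\mathbb{S}^{N-1}\qquad(\ast)$$ has a non-constant solution. Suppose that $$2-\frac{(N-2)(q-1)}{2}+(q-1)\sqrt{\left(\frac{N-2}{2}\right)^2-\frac{N-1}{q-1}}<\ell<2-\frac{(N-2)(q-1)}{2}+(q-1)\sqrt{\left(\frac{N-2}{2}\right)^2-\frac{N-1}{q-1}+\varepsilon_0}.$$ Then problem (P)$_0$ (defined in the context) with $f(|x|,u)=|x|^{-\ell}u^q$ has a nonradial solution. It takes the form $$u(x)=|x|^{-\gamma}V\left(x|x|^{-1}\right),$$ where $\gamma=\frac{2-\ell}{q-1}$ and $V$ is a non-constant solution of $(\ast)$ with $a=\gamma(N-2-\gamma)$.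
   Context: $\Delta_\theta$ is the Laplace–Beltrami operator on the unit sphere $\mathbb{S}^{N-1}\subset\mathbb{R}^N$. A number $\varepsilon_0$ as in the claim exists for all $N\ge4$, $q>q_S$ by a known result of Brezis and Li. Problem (P)$_0$: $u\in C^2(\mathbb{R}^N\setminus\{0\})$, $-\Delta u=f(|x|,u)$ and $u>0$ on $\mathbb{R}^N\setminus\{0\}$, $\lim_{|x|\to\infty}u(x)=0$, $\lim_{x\to0}u(x)=+\infty$. *)

theory Defs
  imports "HOL-Analysis.Analysis"
begin

text \<open>Functions on a subset \<open>S\<close> of a Euclidean space are represented by total functions; the notions
  below depend only on the values on \<open>S\<close>. In \<open>C2_on U\<close> the set \<open>U\<close> is meant to be open.\<close>

definition C2_on :: "'a::euclidean_space set \<Rightarrow> ('a \<Rightarrow> real) \<Rightarrow> bool" where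
  "C2_on U u \<longleftrightarrow>
     (\<exists>(u' :: 'a \<Rightarrow> 'a \<Rightarrow>\<^sub>L real) (u'' :: 'a \<Rightarrow> 'a \<Rightarrow>\<^sub>L 'a \<Rightarrow>\<^sub>L real).
        (\<forall>x\<in>U. (u has_derivative blinfun_apply (u' x)) (at x) \<and>
               (u' has_derivative blinfun_apply (u'' x)) (at x)) \<and>
        continuous_on U u'')"

definition laplacian :: "('a::euclidean_space \<Rightarrow> real) \<Rightarrow> 'a \<Rightarrow> real" where
  "laplacian u x = (\<Sum>b\<in>Basis. deriv (deriv (\<lambda>t. u (x + t *\<^sub>R b))) 0)"

abbreviation unit_sphere :: "'a::euclidean_space set" where
  "unit_sphere \<equiv> sphere 0 1"

text \<open>The usual notion of regularity on a closed embedded submanifold: restrictions of functions of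
  class \<open>C\<^sup>2\<close> on a neighbourhood in the ambient space.\<close>

definition C2_sphere :: "('a::euclidean_space \<Rightarrow> real) \<Rightarrow> bool" where
  "C2_sphere V \<longleftrightarrow>
     (\<exists>U W. open U \<and> unit_sphere \<subseteq> U \<and> C2_on U W \<and> (\<forall>\<theta>\<in>unit_sphere. W \<theta> = V \<theta>))"

text \<open>The tangent space of the sphere at \<open>\<theta>\<close> is the hyperplane orthogonal to \<open>\<theta>\<close>.\<close>

definition tangent_proj :: "'a::euclidean_space \<Rightarrow> 'a \<Rightarrow> 'a" where
  "tangent_proj \<theta> v = v - (v \<bullet> \<theta>) *\<^sub>R \<theta>"

text \<open>The Laplace--Beltrami operator is the divergence of the gradient, for the metric induced by
  the inner product. A derivative at \<open>\<theta>\<close> within the sphere is determined only on tangent vectors,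
  so the gradient is the tangent vector representing it. The covariant
  derivative of a tangent field \<open>X\<close> in a tangent direction \<open>v\<close> is the tangential part of the
  derivative of \<open>X\<close> along \<open>v\<close>, and the divergence is the trace, over the tangent space, of
  the covariant derivative; with \<open>P\<close> the tangential projection and \<open>D\<close> the derivative of \<open>X\<close>, this
  is the trace of \<open>P D P\<close> over the whole space. In particular \<open>D\<close> is applied to tangent vectors
  only, where it does not depend on the choice made by \<^const>\<open>frechet_derivative\<close>.\<close>

definition sphere_grad :: "('a::euclidean_space \<Rightarrow> real) \<Rightarrow> 'a \<Rightarrow> 'a" where
  "sphere_grad V \<theta> =
     (THE g. g \<bullet> \<theta> = 0 \<and> (V has_derivative (\<lambda>h. g \<bullet> h)) (at \<theta> within unit_sphere))"

definition sphere_div :: "('a::euclidean_space \<Rightarrow> 'a) \<Rightarrow> 'a \<Rightarrow> real" where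
  "sphere_div X \<theta> =
     (\<Sum>b\<in>Basis. b \<bullet> tangent_proj \<theta>
        (frechet_derivative X (at \<theta> within unit_sphere) (tangent_proj \<theta> b)))"

definition laplace_beltrami :: "('a::euclidean_space \<Rightarrow> real) \<Rightarrow> 'a \<Rightarrow> real" where
  "laplace_beltrami V = sphere_div (sphere_grad V)"

definition sphere_solution :: "real \<Rightarrow> real \<Rightarrow> ('a::euclidean_space \<Rightarrow> real) \<Rightarrow> bool" where
  "sphere_solution a q V \<longleftrightarrow>
     C2_sphere V \<and>
     (\<forall>\<theta>\<in>unit_sphere. - laplace_beltrami V \<theta> + a * V \<theta> = V \<theta> powr q \<and> V \<theta> > 0)"

definition nonconstant_sphere_solution ::
    "real \<Rightarrow> real \<Rightarrow> ('a::euclidean_space \<Rightarrow> real) \<Rightarrow> bool" where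
  "nonconstant_sphere_solution a q V \<longleftrightarrow> sphere_solution a q V \<and> \<not> V constant_on unit_sphere"

definition P0_solution :: "(real \<Rightarrow> real \<Rightarrow> real) \<Rightarrow> ('a::euclidean_space \<Rightarrow> real) \<Rightarrow> bool" where
  "P0_solution f u \<longleftrightarrow>
     C2_on (UNIV - {0}) u \<and>
     (\<forall>x. x \<noteq> 0 \<longrightarrow> - laplacian u x = f (norm x) (u x) \<and> u x > 0) \<and>
     (u \<longlongrightarrow> 0) at_infinity \<and>
     filterlim u at_top (at 0)"

definition radial :: "('a::euclidean_space \<Rightarrow> real) \<Rightarrow> bool" where
  "radial u \<longleftrightarrow> (\<exists>g. \<forall>x. x \<noteq> 0 \<longrightarrow> u x = g (norm x))"

end

theory Submission
  imports Defs "HOL-Real_Asymp.Real_Asymp"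
begin

text \<open>Extend \<open>V\<close> to the function \<open>F x = V (x / |x|)\<close>, homogeneous of degree \<open>0\<close>. On the
  sphere \<open>\<Delta>\<^sub>\<theta> V = \<Delta> F\<close>, and since \<open>\<nabla>F(x)\<close> is orthogonal to \<open>x\<close>, the product \<open>u = |x|\<^sup>-\<^sup>\<gamma> F\<close>
  satisfies \<open>\<Delta>u = |x|\<^sup>-\<^sup>\<gamma>\<^sup>-\<^sup>2 (\<Delta>\<^sub>\<theta> V - \<gamma> (N - 2 - \<gamma>) V)\<close>. The powers of \<open>|x|\<close> match because
  \<open>l + \<gamma> q = \<gamma> + 2\<close>, and the limits at \<open>0\<close> and infinity follow from \<open>\<gamma> > 0\<close> and the compactness
  of the sphere.\<close>

section \<open>Calculus of maps of class C1 and C2\<close>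

text \<open>The codomain is an arbitrary normed space so that the notion also applies to
  operator-valued maps; \<open>C2_map\<close> uses it for the derivative itself.\<close>

definition C1_map :: "'a::real_normed_vector set \<Rightarrow> ('a \<Rightarrow> 'b::real_normed_vector) \<Rightarrow> bool" where
  "C1_map S f \<longleftrightarrow>
     (\<exists>f'. (\<forall>x\<in>S. (f has_derivative blinfun_apply (f' x)) (at x)) \<and> continuous_on S f')"

definition C2_map :: "'a::real_normed_vector set \<Rightarrow> ('a \<Rightarrow> 'b::real_normed_vector) \<Rightarrow> bool" where
  "C2_map S f \<longleftrightarrow>
     (\<exists>f'. (\<forall>x\<in>S. (f has_derivative blinfun_apply (f' x)) (at x)) \<and> C1_map S f')"

lemma C2_on_iff_C2_map: "C2_on U u \<longleftrightarrow> C2_map U u"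
  unfolding C2_on_def C2_map_def C1_map_def by blast

lemma C1_map_continuous_on: "C1_map S f \<Longrightarrow> continuous_on S f"
  unfolding C1_map_def
  by (metis continuous_at_imp_continuous_on has_derivative_continuous)

lemma C2_map_imp_C1_map: "C2_map S f \<Longrightarrow> C1_map S f"
  unfolding C2_map_def using C1_map_continuous_on by (auto simp: C1_map_def)

lemma C1_map_add:
  assumes "C1_map S f" "C1_map S g"
  shows "C1_map S (\<lambda>x. f x + g x)"
proof -
  obtain f' g' where
    "\<And>x. x \<in> S \<Longrightarrow> (f has_derivative blinfun_apply (f' x)) (at x)" "continuous_on S f'"
    "\<And>x. x \<in> S \<Longrightarrow> (g has_derivative blinfun_apply (g' x)) (at x)" "continuous_on S g'"
    using assms unfolding C1_map_def by blast
  then show ?thesis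
    unfolding C1_map_def
    by (intro exI[of _ "\<lambda>x. f' x + g' x"])
       (auto simp: plus_blinfun.rep_eq intro!: derivative_eq_intros continuous_intros)
qed

lemma C1_map_linear: "bounded_linear f \<Longrightarrow> C1_map S f"
  unfolding C1_map_def
  by (intro exI[of _ "\<lambda>_. Blinfun f"])
     (auto simp: bounded_linear_Blinfun_apply bounded_linear_imp_has_derivative)

lemma C1_map_const: "C1_map S (\<lambda>_. c)"
  unfolding C1_map_def by (intro exI[of _ "\<lambda>_. 0"]) (auto simp: zero_blinfun.rep_eq)

lemma C1_map_compose:
  assumes g: "C1_map T g" and f: "C1_map S f" and "f ` S \<subseteq> T"
  shows "C1_map S (\<lambda>x. g (f x))"
proof -
  obtain f' g' where f':
    "\<And>x. x \<in> S \<Longrightarrow> (f has_derivative blinfun_apply (f' x)) (at x)" "continuous_on S f'"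
    and g': "\<And>x. x \<in> T \<Longrightarrow> (g has_derivative blinfun_apply (g' x)) (at x)" "continuous_on T g'"
    using f g unfolding C1_map_def by blast
  let ?d = "\<lambda>x. g' (f x) o\<^sub>L f' x"
  have "((\<lambda>x. g (f x)) has_derivative blinfun_apply (?d x)) (at x)" if "x \<in> S" for x
    using has_derivative_compose[OF f'(1) g'(1)] that \<open>f ` S \<subseteq> T\<close>
    by (auto simp: blinfun_compose.rep_eq o_def image_subset_iff)
  moreover have "continuous_on S ?d"
    by (rule bounded_bilinear.continuous_on[OF bounded_bilinear_blinfun_compose
          continuous_on_compose2[OF g'(2) C1_map_continuous_on[OF f] \<open>f ` S \<subseteq> T\<close>] f'(2)])
  ultimately show ?thesis
    unfolding C1_map_def by (intro exI[of _ ?d] conjI ballI)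
qed

lemma C1_map_bounded_linear_compose:
  "bounded_linear L \<Longrightarrow> C1_map S f \<Longrightarrow> C1_map S (\<lambda>x. L (f x))"
  using C1_map_compose[OF C1_map_linear, of L S f UNIV] by simp

text \<open>One product rule serves scalar multiples, inner products and, above all, composition of
  bounded linear maps. The last case makes derivatives given by the product and chain rules C1 in
  turn.\<close>

lemma (in bounded_bilinear) C1_map:
  assumes "C1_map S f" "C1_map S g"
  shows "C1_map S (\<lambda>x. prod (f x) (g x))"
proof -
  obtain f' g' where f':
    "\<And>x. x \<in> S \<Longrightarrow> (f has_derivative blinfun_apply (f' x)) (at x)" "continuous_on S f'"
    and g': "\<And>x. x \<in> S \<Longrightarrow> (g has_derivative blinfun_apply (g' x)) (at x)" "continuous_on S g'"
    using assms unfolding C1_map_def by blast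
  let ?d = "\<lambda>x. (prod_right (f x) o\<^sub>L g' x) + (prod_left (g x) o\<^sub>L f' x)"
  have "((\<lambda>x. prod (f x) (g x)) has_derivative blinfun_apply (?d x)) (at x)" if "x \<in> S" for x
    using FDERIV[OF f'(1)[OF that] g'(1)[OF that]]
    by (simp add: plus_blinfun.rep_eq o_def)
  moreover have "continuous_on S ?d"
    by (rule continuous_on_add[OF
          bounded_bilinear.continuous_on[OF bounded_bilinear_blinfun_compose
            bounded_linear.continuous_on[OF bounded_linear_prod_right C1_map_continuous_on[OF assms(1)]]
            g'(2)]
          bounded_bilinear.continuous_on[OF bounded_bilinear_blinfun_compose
            bounded_linear.continuous_on[OF bounded_linear_prod_left C1_map_continuous_on[OF assms(2)]]
            f'(2)]])
  ultimately show ?thesis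
    unfolding C1_map_def by (intro exI[of _ ?d] conjI ballI)
qed

lemma C2_map_linear: "bounded_linear f \<Longrightarrow> C2_map S f"
  unfolding C2_map_def
  by (intro exI[of _ "\<lambda>_. Blinfun f"])
     (auto simp: bounded_linear_Blinfun_apply bounded_linear_imp_has_derivative C1_map_const)

lemma (in bounded_bilinear) C2_map:
  assumes "C2_map S f" "C2_map S g"
  shows "C2_map S (\<lambda>x. prod (f x) (g x))"
proof -
  obtain f' g' where f':
    "\<And>x. x \<in> S \<Longrightarrow> (f has_derivative blinfun_apply (f' x)) (at x)" "C1_map S f'"
    and g': "\<And>x. x \<in> S \<Longrightarrow> (g has_derivative blinfun_apply (g' x)) (at x)" "C1_map S g'"
    using assms unfolding C2_map_def by blast
  let ?d = "\<lambda>x. (prod_right (f x) o\<^sub>L g' x) + (prod_left (g x) o\<^sub>L f' x)"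
  have "((\<lambda>x. prod (f x) (g x)) has_derivative blinfun_apply (?d x)) (at x)" if "x \<in> S" for x
    using FDERIV[OF f'(1)[OF that] g'(1)[OF that]]
    by (simp add: plus_blinfun.rep_eq o_def)
  moreover have "C1_map S ?d"
    by (rule C1_map_add[OF
          bounded_bilinear.C1_map[OF bounded_bilinear_blinfun_compose
            C1_map_bounded_linear_compose[OF bounded_linear_prod_right C2_map_imp_C1_map[OF assms(1)]]
            g'(2)]
          bounded_bilinear.C1_map[OF bounded_bilinear_blinfun_compose
            C1_map_bounded_linear_compose[OF bounded_linear_prod_left C2_map_imp_C1_map[OF assms(2)]]
            f'(2)]])
  ultimately show ?thesis
    unfolding C2_map_def by (intro exI[of _ ?d] conjI ballI)
qed

text \<open>The derivative \<open>g' (f x) o\<^sub>L f' x\<close> is a bilinear expression in two C1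
  maps, so the C1 product rule applies to it.\<close>

lemma C2_map_compose:
  assumes g: "C2_map T g" and f: "C2_map S f" and "f ` S \<subseteq> T"
  shows "C2_map S (\<lambda>x. g (f x))"
proof -
  obtain f' g' where f':
    "\<And>x. x \<in> S \<Longrightarrow> (f has_derivative blinfun_apply (f' x)) (at x)" "C1_map S f'"
    and g': "\<And>x. x \<in> T \<Longrightarrow> (g has_derivative blinfun_apply (g' x)) (at x)" "C1_map T g'"
    using f g unfolding C2_map_def by blast
  let ?d = "\<lambda>x. g' (f x) o\<^sub>L f' x"
  have "((\<lambda>x. g (f x)) has_derivative blinfun_apply (?d x)) (at x)" if "x \<in> S" for x
    using has_derivative_compose[OF f'(1) g'(1)] that \<open>f ` S \<subseteq> T\<close>
    by (auto simp: blinfun_compose.rep_eq o_def image_subset_iff)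
  moreover have "C1_map S ?d"
    by (rule bounded_bilinear.C1_map[OF bounded_bilinear_blinfun_compose
          C1_map_compose[OF g'(2) C2_map_imp_C1_map[OF f] \<open>f ` S \<subseteq> T\<close>] f'(2)])
  ultimately show ?thesis
    unfolding C2_map_def by (intro exI[of _ ?d] conjI ballI)
qed

section \<open>Real powers and powers of the norm\<close>

lemma has_derivative_powr_const:
  fixes t p :: real
  assumes "t > 0"
  shows "((\<lambda>t. t powr p) has_derivative
          blinfun_apply ((p * t powr (p - 1)) *\<^sub>R id_blinfun)) (at t)"
  using assms
  by (auto intro!: derivative_eq_intros simp: scaleR_blinfun.rep_eq powr_diff field_simps)

lemma C1_map_powr: "C1_map {0<..} (\<lambda>t::real. t powr p)"
  unfolding C1_map_def
  by (intro exI[of _ "\<lambda>t. (p * t powr (p - 1)) *\<^sub>R id_blinfun"] conjI ballI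
      has_derivative_powr_const continuous_intros) auto

text \<open>The derivative is a constant multiple of a power times \<open>id_blinfun\<close>, so the
  C1 case with exponent \<open>p - 1\<close> finishes the argument.\<close>

lemma C2_map_powr: "C2_map {0<..} (\<lambda>t::real. t powr p)"
  unfolding C2_map_def
  by (intro exI[of _ "\<lambda>t. (p * t powr (p - 1)) *\<^sub>R id_blinfun"] conjI ballI
      has_derivative_powr_const
      bounded_bilinear.C1_map[OF bounded_bilinear_scaleR
        bounded_bilinear.C1_map[OF bounded_bilinear_mult C1_map_const C1_map_powr] C1_map_const])
     simp

text \<open>Writing the function as \<open>(x \<bullet> x) powr (p / 2)\<close> avoids
  differentiating the norm twice: the inner map is bilinear in \<open>x\<close> and positive off the
  origin.\<close>

lemma C2_map_norm_powr: "C2_map (UNIV - {0}) (\<lambda>x::'a::real_inner. norm x powr p)"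
proof -
  have "C2_map (UNIV - {0}) (\<lambda>x::'a. (x \<bullet> x) powr (p / 2))"
    by (rule C2_map_compose[OF C2_map_powr bounded_bilinear.C2_map[OF bounded_bilinear_inner]])
       (auto intro: C2_map_linear)
  moreover have "(x \<bullet> x) powr (p / 2) = norm x powr p" for x :: 'a
    by (simp add: powr_powr norm_eq_sqrt_inner powr_half_sqrt[symmetric])
  ultimately show ?thesis by simp
qed

text \<open>Of the two powers lost in \<open>p - 2\<close>, one comes from the power rule and one
  from the gradient \<open>x / norm x\<close> of the norm.\<close>

lemma has_derivative_norm_powr:
  fixes x :: "'a::real_inner"
  assumes "x \<noteq> 0"
  shows "((\<lambda>x. norm x powr p) has_derivative (\<lambda>h. p * norm x powr (p - 2) * (x \<bullet> h))) (at x)"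
proof -
  have "norm x powr p / norm x / norm x = norm x powr (p - 2)"
    using assms by (simp add: powr_diff power2_eq_square)
  then show ?thesis
    using assms
    by (auto intro!: derivative_eq_intros has_derivative_norm 
        simp: sgn_div_norm inner_commute divide_inverse algebra_simps fun_eq_iff)
qed

section \<open>Homogeneous extensions and the Laplace--Beltrami operator\<close>

text \<open>This passes from the iterated one-variable derivatives in \<open>laplacian\<close> to
  Frechet derivatives; \<open>h b b\<close> is the second derivative in direction
  \<open>b\<close>.\<close>

lemma laplacian_eq_sum:
  fixes u :: "'a::euclidean_space \<Rightarrow> real"
  assumes "open U" "x \<in> U"
    and d: "\<And>y. y \<in> U \<Longrightarrow> (u has_derivative d y) (at y)"
    and h: "\<And>b. b \<in> Basis \<Longrightarrow> ((\<lambda>y. d y b) has_derivative h b) (at x)"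
  shows "laplacian u x = (\<Sum>b\<in>Basis. h b b)"
  unfolding laplacian_def
proof (intro sum.cong refl)
  fix b :: 'a assume b: "b \<in> Basis"
  let ?c = "\<lambda>t::real. x + t *\<^sub>R b"
  have c: "(?c has_derivative (\<lambda>s. s *\<^sub>R b)) (at t)" for t
    by (auto intro!: derivative_eq_intros)
  have along: "DERIV (\<lambda>t. f (?c t)) t :> D b"
    if "(f has_derivative D) (at (?c t))" for f :: "'a \<Rightarrow> real" and D t
    using has_derivative_compose[OF c that] 
      linear_cmul[OF has_derivative_linear[OF that]]
    by (simp add: has_field_derivative_def mult_commute_abs)
  have "open (?c -` U)"
    by (intro continuous_open_vimage \<open>open U\<close>) (auto intro!: continuous_intros)
  then have "\<forall>\<^sub>F t in nhds 0. ?c t \<in> U"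
    using \<open>x \<in> U\<close> eventually_nhds_in_open[of "?c -` U" 0] by simp
  \<comment> \<open>The outer derivative at 0 sees the inner one on a neighbourhood of 0, so the
    first derivative must be identified for all small \<open>t\<close>.\<close>
  then have "\<forall>\<^sub>F t in nhds 0. deriv (\<lambda>t. u (?c t)) t = d (?c t) b"
    by eventually_elim (rule DERIV_imp_deriv[OF along[OF d]])
  then have "deriv (deriv (\<lambda>t. u (?c t))) 0 = deriv (\<lambda>t. d (?c t) b) 0"
    by (rule deriv_cong_ev) simp
  also have "\<dots> = h b b"
    using h[OF b] by (intro DERIV_imp_deriv along) simp
  finally show "deriv (deriv (\<lambda>t. u (?c t))) 0 = h b b" .
qed

text \<open>A great circle through \<open>\<theta>\<close> in direction \<open>v\<close> turns this into uniqueness of one-dimensional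
  derivatives.\<close>

lemma has_derivative_sphere_unique:
  fixes f :: "'a::euclidean_space \<Rightarrow> 'b::real_normed_vector"
  assumes \<theta>: "\<theta> \<in> unit_sphere"
    and D: "(f has_derivative D) (at \<theta> within unit_sphere)"
    and E: "(f has_derivative E) (at \<theta> within unit_sphere)"
    and v: "v \<bullet> \<theta> = 0"
  shows "D v = E v"
proof (cases "v = 0")
  case True
  then show ?thesis
    using D E by (simp add: has_derivative_linear linear_0)
next
  case False
  \<comment> \<open>The unit length of \<open>w\<close> keeps the curve \<open>c\<close> on the
    sphere. The vector \<open>v\<close> is recovered at the end by taking \<open>s = norm v\<close>
    in the derivative along \<open>c\<close>.\<close>
  define w where "w = v /\<^sub>R norm v"
  have w: "w \<bullet> \<theta> = 0" "w \<bullet> w = 1" "v = norm v *\<^sub>R w"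
    using False v by (auto simp: w_def dot_square_norm power2_eq_square)
  define c where "c t = cos t *\<^sub>R \<theta> + sin t *\<^sub>R w" for t
  have "\<theta> \<bullet> \<theta> = 1"
    using \<theta> by (simp add: dot_square_norm)
  then have "c t \<bullet> c t = 1" for t
    using w(1,2) by (simp add: c_def inner_add inner_commute flip: power2_eq_square)
  then have sub: "c ` UNIV \<subseteq> unit_sphere"
    by (auto simp: norm_eq_1)
  have c: "(c has_derivative (\<lambda>s. s *\<^sub>R w)) (at 0)"
    unfolding c_def by (auto intro!: derivative_eq_intros)
  have c0: "c 0 = \<theta>"
    by (simp add: c_def)
  have "((\<lambda>t. f (c t)) has_derivative (\<lambda>s. L (s *\<^sub>R w))) (at 0)"
    if "(f has_derivative L) (at \<theta> within unit_sphere)" for L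
    using has_derivative_in_compose[OF c, of f L] has_derivative_subset[OF that sub] c0
    by simp
  from has_derivative_unique[OF this[OF D] this[OF E]]
  have "D (norm v *\<^sub>R w) = E (norm v *\<^sub>R w)"
    by meson
  then show ?thesis
    using w(3) by simp
qed

section \<open>Functions homogeneous of degree 0\<close>

context
  fixes F :: "'a::euclidean_space \<Rightarrow> real"
    and F' :: "'a \<Rightarrow> 'a \<Rightarrow>\<^sub>L real" and F'' :: "'a \<Rightarrow> 'a \<Rightarrow>\<^sub>L 'a \<Rightarrow>\<^sub>L real"
  assumes hom: "\<And>x t. x \<noteq> 0 \<Longrightarrow> t > 0 \<Longrightarrow> F (t *\<^sub>R x) = F x"
    and F': "\<And>x. x \<noteq> 0 \<Longrightarrow> (F has_derivative blinfun_apply (F' x)) (at x)"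
    and F'': "\<And>x. x \<noteq> 0 \<Longrightarrow> (F' has_derivative blinfun_apply (F'' x)) (at x)"
begin

text \<open>Differentiate \<open>F (t *\<^sub>R x) = F x\<close> in \<open>x\<close>; the chain rule
  contributes a factor \<open>t\<close>.\<close>

lemma hom0_derivative_scale:
  assumes "x \<noteq> 0" "t > 0"
  shows "F' (t *\<^sub>R x) = F' x /\<^sub>R t"
proof -
  have "((\<lambda>y. F (t *\<^sub>R y)) has_derivative (\<lambda>h. F' (t *\<^sub>R x) (t *\<^sub>R h))) (at x)"
    by (rule has_derivative_compose[OF _ F']) (use assms in \<open>auto intro!: derivative_eq_intros\<close>)
  then have "(F has_derivative (\<lambda>h. F' (t *\<^sub>R x) (t *\<^sub>R h))) (at x)"
    by (rule has_derivative_transform_within_open[of _ _ _ _ "- {0}"]) (use assms hom in auto)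
  from has_derivative_unique[OF this F'[OF assms(1)]] show ?thesis
    using assms by (auto simp: blinfun_eqI scaleR_blinfun.rep_eq blinfun.scaleR_right
        fun_eq_iff field_simps intro!: blinfun_eqI)
qed

text \<open>Differentiating the scaling law of \<open>F'\<close> gives a second factor
  \<open>t\<close>.\<close>

lemma hom0_second_derivative_scale:
  assumes "x \<noteq> 0" "t > 0"
  shows "F'' (t *\<^sub>R x) h = F'' x h /\<^sub>R t\<^sup>2"
proof -
  have "((\<lambda>y. F' (t *\<^sub>R y)) has_derivative (\<lambda>h. F'' (t *\<^sub>R x) (t *\<^sub>R h))) (at x)"
    by (rule has_derivative_compose[OF _ F'']) (use assms in \<open>auto intro!: derivative_eq_intros\<close>)
  then have "((\<lambda>y. F' y /\<^sub>R t) has_derivative (\<lambda>h. F'' (t *\<^sub>R x) (t *\<^sub>R h))) (at x)"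
    by (rule has_derivative_transform_within_open[of _ _ _ _ "- {0}"])
       (use assms hom0_derivative_scale in auto)
  moreover have "((\<lambda>y. F' y /\<^sub>R t) has_derivative (\<lambda>h. F'' x h /\<^sub>R t)) (at x)"
    using F''[OF assms(1)] by (auto intro!: derivative_eq_intros)
  ultimately have "(\<lambda>h. F'' (t *\<^sub>R x) (t *\<^sub>R h)) = (\<lambda>h. F'' x h /\<^sub>R t)"
    by (rule has_derivative_unique)
  then have "F'' (t *\<^sub>R x) (t *\<^sub>R h) = F'' x h /\<^sub>R t"
    by (rule fun_cong)
  then have "inverse t *\<^sub>R t *\<^sub>R F'' (t *\<^sub>R x) h = inverse t *\<^sub>R (F'' x h /\<^sub>R t)"
    by (simp add: blinfun.scaleR_right)
  then show ?thesis
    using assms by (simp add: power2_eq_square)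
qed

text \<open>Euler's identity in degree 0: \<open>F\<close> is constant along the open ray through
  \<open>x\<close>.\<close>

lemma hom0_derivative_radial:
  assumes "x \<noteq> 0"
  shows "F' x x = 0"
proof -
  have "((\<lambda>t::real. F (t *\<^sub>R x)) has_derivative (\<lambda>s. F' x (s *\<^sub>R x))) (at 1)"
    by (rule has_derivative_compose[where g = F]) (use assms F' in \<open>auto intro!: derivative_eq_intros\<close>)
  then have "((\<lambda>t::real. F x) has_derivative (\<lambda>s. F' x (s *\<^sub>R x))) (at 1)"
    by (rule has_derivative_transform_within_open[of _ _ _ _ "{0<..}"]) (use assms hom in auto)
  from has_derivative_unique[OF this has_derivative_const] show ?thesis
    by (metis scaleR_one)
qed

text \<open>Differentiate Euler's identity \<open>F' y y = 0\<close> at \<open>x\<close> in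
  direction \<open>x\<close>. The product rule also produces \<open>F' x x\<close>, which vanishes
  by the same identity.\<close>

lemma hom0_second_derivative_radial:
  assumes "x \<noteq> 0"
  shows "F'' x x x = 0"
proof -
  have "((\<lambda>y. F' y y) has_derivative (\<lambda>h. F' x h + F'' x h x)) (at x)"
    using F''[OF assms]
    by (auto intro!: derivative_eq_intros bounded_bilinear.FDERIV[OF bounded_bilinear_blinfun_apply])
  then have "((\<lambda>y. 0) has_derivative (\<lambda>h. F' x h + F'' x h x)) (at x)"
    by (rule has_derivative_transform_within_open[of _ _ _ _ "- {0}"])
       (use assms hom0_derivative_radial in auto)
  from has_derivative_unique[OF this has_derivative_const] show ?thesis
    using hom0_derivative_radial[OF assms] by (metis add_0)
qed

text \<open>The tangential gradient of \<open>V\<close> is the Euclidean gradient of \<open>F\<close>, and with \<open>H\<close> the Hessian of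
  \<open>F\<close> the trace of \<open>P H P\<close> is the trace of \<open>H\<close> since \<open>\<theta> \<bullet> H \<theta> = 0\<close>.\<close>

lemma laplace_beltrami_hom0:
  assumes V: "\<And>\<theta>. \<theta> \<in> unit_sphere \<Longrightarrow> V \<theta> = F \<theta>" and \<theta>: "\<theta> \<in> unit_sphere"
  shows "laplace_beltrami V \<theta> = (\<Sum>b\<in>Basis. F'' \<theta> b b)"
proof -
  define G where "G x = (\<Sum>b\<in>Basis. F' x b *\<^sub>R b)" for x
  define H where "H h = (\<Sum>b\<in>Basis. F'' \<theta> h b *\<^sub>R b)" for h
  \<comment> \<open>Riesz representation in coordinates: it identifies \<open>G x\<close> as the
    gradient of \<open>F\<close> at \<open>x\<close> and \<open>H\<close> as the derivative of this
    gradient field at \<theta>.\<close>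
  have repr: "(\<Sum>b\<in>Basis. L b *\<^sub>R b) \<bullet> h = L h" for L :: "'a \<Rightarrow>\<^sub>L real" and h
  proof -
    have "(\<Sum>b\<in>Basis. L b *\<^sub>R b) \<bullet> h = (\<Sum>b\<in>Basis. L ((h \<bullet> b) *\<^sub>R b))"
      by (simp add: inner_sum_left blinfun.scaleR_right inner_commute[of h] mult.commute)
    also have "\<dots> = L h"
      by (simp flip: blinfun.sum_right add: euclidean_representation)
    finally show ?thesis .
  qed
  have nz: "x \<noteq> 0" if "x \<in> unit_sphere" for x :: 'a
    using that by auto
  have grad: "sphere_grad V x = G x" if x: "x \<in> unit_sphere" for x
    unfolding sphere_grad_def
  proof (rule the_equality)
    have "(\<bullet>) (G x) = blinfun_apply (F' x)"
      by (simp add: fun_eq_iff G_def repr)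
    then have "(F has_derivative (\<bullet>) (G x)) (at x within unit_sphere)"
      using F'[OF nz[OF x]] by (simp add: has_derivative_at_withinI)
    then have *: "(V has_derivative (\<bullet>) (G x)) (at x within unit_sphere)"
      by (rule has_derivative_transform[rotated 2]) (use x V in auto)
    moreover have Gx: "G x \<bullet> x = 0"
      using hom0_derivative_radial[OF nz[OF x]] by (simp add: G_def repr)
    ultimately show "G x \<bullet> x = 0 \<and> (V has_derivative (\<bullet>) (G x)) (at x within unit_sphere)"
      by simp
    fix g assume g: "g \<bullet> x = 0 \<and> (V has_derivative (\<bullet>) g) (at x within unit_sphere)"
    \<comment> \<open>The difference of two candidates is itself tangent, so both may be tested on
      it; this shows that its square norm is 0.\<close>
    then have "(g - G x) \<bullet> x = 0"
      using Gx by (simp add: inner_diff_left)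
    with has_derivative_sphere_unique[OF x _ * this] g
    have "g \<bullet> (g - G x) = G x \<bullet> (g - G x)" by blast
    then have "(g - G x) \<bullet> (g - G x) = 0"
      by (simp add: inner_diff_left)
    then show "g = G x" by simp
  qed
  have "(G has_derivative H) (at \<theta>)"
    unfolding G_def[abs_def] H_def[abs_def]
    using F''[OF nz[OF \<theta>]]
    by (auto intro!: derivative_eq_intros bounded_bilinear.FDERIV[OF bounded_bilinear_blinfun_apply])
  then have H: "(sphere_grad V has_derivative H) (at \<theta> within unit_sphere)"
    by (intro has_derivative_transform[OF \<theta> _ has_derivative_at_withinI]) (simp_all add: grad)
  let ?D = "frechet_derivative (sphere_grad V) (at \<theta> within unit_sphere)"
  have D: "(sphere_grad V has_derivative ?D) (at \<theta> within unit_sphere)"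
    using H by (auto simp: frechet_derivative_works[symmetric] differentiable_def)
  have \<theta>\<theta>: "\<theta> \<bullet> \<theta> = 1"
    using \<theta> by (simp add: dot_square_norm)
  let ?P = "tangent_proj \<theta>"
  \<comment> \<open>The derivative chosen by \<open>frechet_derivative\<close> need not equal
    \<open>H\<close>, but the two agree on tangent vectors.\<close>
  have DH: "?D (?P b) = H (?P b)" for b
    by (rule has_derivative_sphere_unique[OF \<theta> D H])
       (simp add: tangent_proj_def inner_diff_left \<theta>\<theta>)
  \<comment> \<open>The projection is self-adjoint and moves to the other argument.\<close>
  have PH: "b \<bullet> ?P (H w) = F'' \<theta> w (?P b)" for b w
  proof -
    have "b \<bullet> ?P (H w) = H w \<bullet> ?P b"
      by (simp add: tangent_proj_def inner_diff_right inner_commute)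
    then show ?thesis
      by (simp add: H_def repr)
  qed
  have rad: "F'' \<theta> \<theta> \<theta> = 0"
    by (rule hom0_second_derivative_radial[OF nz[OF \<theta>]])
  \<comment> \<open>The two mixed terms of the trace of \<open>P H P\<close> are treated separately,
    so symmetry of the second derivative does not enter. Each sums to
    \<open>F'' \<theta> \<theta> \<theta>\<close>.\<close>
  have s1: "(\<Sum>b\<in>Basis. (b \<bullet> \<theta>) * F'' \<theta> b \<theta>) = 0"
  proof -
    have "(\<Sum>b\<in>Basis. (b \<bullet> \<theta>) * F'' \<theta> b \<theta>) = F'' \<theta> (\<Sum>b\<in>Basis. (\<theta> \<bullet> b) *\<^sub>R b) \<theta>"
      by (simp add: blinfun.sum_right blinfun.sum_left blinfun.scaleR_right blinfun.scaleR_left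
          inner_commute)
    then show ?thesis by (simp add: euclidean_representation rad)
  qed
  have s2: "(\<Sum>b\<in>Basis. (b \<bullet> \<theta>) * F'' \<theta> \<theta> b) = 0"
  proof -
    have "(\<Sum>b\<in>Basis. (b \<bullet> \<theta>) * F'' \<theta> \<theta> b) = F'' \<theta> \<theta> (\<Sum>b\<in>Basis. (\<theta> \<bullet> b) *\<^sub>R b)"
      by (simp add: blinfun.sum_right blinfun.scaleR_right inner_commute)
    then show ?thesis by (simp add: euclidean_representation rad)
  qed
  have "laplace_beltrami V \<theta> = (\<Sum>b\<in>Basis. F'' \<theta> (?P b) (?P b))"
    by (simp add: laplace_beltrami_def sphere_div_def DH PH)
  also have "\<dots> = (\<Sum>b\<in>Basis. F'' \<theta> b b - (b \<bullet> \<theta>) * F'' \<theta> \<theta> b - (b \<bullet> \<theta>) * F'' \<theta> b \<theta>)"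
    by (simp add: tangent_proj_def blinfun.diff_right blinfun.diff_left blinfun.scaleR_right
        blinfun.scaleR_left rad)
  finally show ?thesis
    by (simp add: sum_subtractf s1 s2)
qed

text \<open>In the product rule the Laplacian of the power contributes \<open>\<gamma> * (\<gamma> +
  2) - \<gamma> * N = - \<gamma> * (N - 2 - \<gamma>)\<close> with \<open>N\<close> the dimension,
  the cross term vanishes by Euler's identity, and the Hessian of \<open>F\<close> scales like
  \<open>norm x powr (- 2)\<close>.\<close>

lemma laplacian_norm_powr_hom0:
  fixes x :: 'a and V :: "'a \<Rightarrow> real" and \<gamma> :: real
  assumes x: "x \<noteq> 0" and V: "\<And>\<theta>. \<theta> \<in> unit_sphere \<Longrightarrow> V \<theta> = F \<theta>"
  defines "\<theta> \<equiv> x /\<^sub>R norm x"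
  shows "laplacian (\<lambda>y. norm y powr (- \<gamma>) * F y) x =
    norm x powr (- \<gamma> - 2) * (laplace_beltrami V \<theta> - \<gamma> * (real DIM('a) - 2 - \<gamma>) * V \<theta>)"
proof -
  let ?r = "norm x"
  \<comment> \<open>The gradient of \<open>norm y powr (- \<gamma>)\<close> is
    \<open>\<mu> y *\<^sub>R y\<close>. Below, \<open>h b k\<close> is the derivative in direction
    \<open>k\<close> of the partial derivative of the product in direction \<open>b\<close>.\<close>
  define \<mu> where "\<mu> = (\<lambda>y::'a. - \<gamma> * norm y powr (- \<gamma> - 2))"
  define h where "h b k =
      ((\<gamma> * (\<gamma> + 2) * ?r powr (- \<gamma> - 4) * (x \<bullet> k)) * (x \<bullet> b) + \<mu> x * (k \<bullet> b)) * F x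
      + \<mu> x * (x \<bullet> b) * F' x k
      + (\<mu> x * (x \<bullet> k) * F' x b + ?r powr (- \<gamma>) * F'' x k b)" for b k
  have \<theta>: "\<theta> \<in> unit_sphere" "\<theta> \<noteq> 0" and x\<theta>: "x = ?r *\<^sub>R \<theta>" and r: "?r > 0"
    using x by (auto simp: \<theta>_def)
  have "laplacian (\<lambda>y. norm y powr (- \<gamma>) * F y) x = (\<Sum>b\<in>Basis. h b b)"
  proof (rule laplacian_eq_sum[where h = h])
    show "open (- {0 :: 'a})" "x \<in> - {0}"
      using x by auto
    show "((\<lambda>y. norm y powr (- \<gamma>) * F y) has_derivative
        (\<lambda>b. \<mu> y * (y \<bullet> b) * F y + norm y powr (- \<gamma>) * F' y b)) (at y)" if "y \<in> - {0}" for y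
      using that
      by (auto intro!: has_derivative_eq_rhs[OF has_derivative_mult[OF has_derivative_norm_powr F']]
          simp: \<mu>_def fun_eq_iff)
    show "((\<lambda>y. \<mu> y * (y \<bullet> b) * F y + norm y powr (- \<gamma>) * F' y b) has_derivative h b) (at x)"
      for b
    proof -
      have d\<mu>: "(\<mu> has_derivative (\<lambda>k. \<gamma> * (\<gamma> + 2) * ?r powr (- \<gamma> - 4) * (x \<bullet> k))) (at x)"
        using has_derivative_mult_right[OF has_derivative_norm_powr[OF x, of "- \<gamma> - 2"], of "- \<gamma>"]
        by (simp add: \<mu>_def algebra_simps)
      have d\<psi>: "((\<lambda>y. norm y powr (- \<gamma>)) has_derivative (\<lambda>k. \<mu> x * (x \<bullet> k))) (at x)"
        using has_derivative_norm_powr[OF x, of "- \<gamma>"] by (simp add: \<mu>_def)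
      have dF': "((\<lambda>y. F' y b) has_derivative (\<lambda>k. F'' x k b)) (at x)"
        using bounded_linear.has_derivative[OF blinfun.bounded_linear_left F''[OF x]] .
      have d_inner: "((\<lambda>y. y \<bullet> b) has_derivative (\<lambda>k. k \<bullet> b)) (at x)"
        by (auto intro!: derivative_eq_intros)
      show ?thesis
        using has_derivative_add[OF
            has_derivative_mult[OF has_derivative_mult[OF d\<mu> d_inner] F'[OF x]]
            has_derivative_mult[OF d\<psi> dF']]
        by (rule has_derivative_eq_rhs) (simp add: h_def fun_eq_iff algebra_simps)
    qed
  qed
  also have "\<dots> = \<gamma> * (\<gamma> + 2) * ?r powr (- \<gamma> - 4) * (\<Sum>b\<in>Basis. (x \<bullet> b)\<^sup>2) * F x
      + \<mu> x * (\<Sum>b\<in>Basis. (b::'a) \<bullet> b) * F x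
      + 2 * \<mu> x * (\<Sum>b\<in>Basis. (x \<bullet> b) * F' x b)
      + ?r powr (- \<gamma>) * (\<Sum>b\<in>Basis. F'' x b b)"
    by (simp add: h_def sum.distrib sum_distrib_left sum_distrib_right power2_eq_square
        algebra_simps)
  also have "(\<Sum>b\<in>Basis. (x \<bullet> b) * F' x b) = F' x (\<Sum>b\<in>Basis. (x \<bullet> b) *\<^sub>R b)"
    by (simp add: blinfun.sum_right blinfun.scaleR_right)
  also have "\<dots> = 0"
    by (simp add: euclidean_representation hom0_derivative_radial[OF x])
  also have "(\<Sum>b\<in>Basis. (x \<bullet> b)\<^sup>2) = ?r\<^sup>2"
    by (simp add: norm_eq_sqrt_inner euclidean_inner[of x x] power2_eq_square sum_nonneg)
  also have "(\<Sum>b\<in>Basis. (b::'a) \<bullet> b) = DIM('a)"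
    by simp
  also have "(\<Sum>b\<in>Basis. F'' x b b) = laplace_beltrami V \<theta> / ?r\<^sup>2"
  proof -
    have "F'' x b b = F'' \<theta> b b / ?r\<^sup>2" for b
      using hom0_second_derivative_scale[OF \<theta>(2) r, of b] x\<theta>
      by (simp add: scaleR_blinfun.rep_eq divide_inverse)
    moreover have "laplace_beltrami V \<theta> = (\<Sum>b\<in>Basis. F'' \<theta> b b)"
      by (rule laplace_beltrami_hom0) (use V \<theta>(1) in auto)
    ultimately show ?thesis
      by (simp add: sum_divide_distrib)
  qed
  also have "F x = V \<theta>"
    using hom[OF \<theta>(2) r] V[OF \<theta>(1)] x\<theta> by simp
  also have "\<gamma> * (\<gamma> + 2) * ?r powr (- \<gamma> - 4) * ?r\<^sup>2 = \<gamma> * (\<gamma> + 2) * ?r powr (- \<gamma> - 2)"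
    using r by (simp add: powr_diff field_simps flip: power_add)
  also have "?r powr (- \<gamma>) * (laplace_beltrami V \<theta> / ?r\<^sup>2) =
      ?r powr (- \<gamma> - 2) * laplace_beltrami V \<theta>"
    using r by (simp add: powr_diff)
  finally show ?thesis
    by (simp add: \<mu>_def algebra_simps)
qed

end


section \<open>The solutions in separated form\<close>

text \<open>Compactness of the sphere turns positivity of the continuous function \<open>V\<close>
  into a uniform positive lower bound. The two bounds control the separated solution at 0 and at
  infinity.\<close>

lemma sphere_solution_bounds:
  fixes V :: "'a::euclidean_space \<Rightarrow> real"
  assumes "sphere_solution a q V"
  obtains m M where "m > 0" "\<And>\<theta>. \<theta> \<in> unit_sphere \<Longrightarrow> m \<le> V \<theta> \<and> V \<theta> \<le> M"
proof -
  obtain U W where "unit_sphere \<subseteq> U" "C2_on U W" and W: "\<And>\<theta>. \<theta> \<in> unit_sphere \<Longrightarrow> W \<theta> = V \<theta>"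
    using assms unfolding sphere_solution_def C2_sphere_def by blast
  then have "continuous_on unit_sphere W"
    by (metis C1_map_continuous_on C2_map_imp_C1_map C2_on_iff_C2_map continuous_on_subset)
  then have V: "continuous_on unit_sphere V"
    by (rule continuous_on_eq) (rule W)
  have ne: "unit_sphere \<noteq> ({} :: 'a set)"
    by simp
  obtain \<theta>0 where \<theta>0: "\<theta>0 \<in> unit_sphere" "\<And>\<theta>. \<theta> \<in> unit_sphere \<Longrightarrow> V \<theta>0 \<le> V \<theta>"
    using continuous_attains_inf[OF compact_sphere ne V] by blast
  obtain \<theta>1 where "\<theta>1 \<in> unit_sphere" "\<And>\<theta>. \<theta> \<in> unit_sphere \<Longrightarrow> V \<theta> \<le> V \<theta>1"
    using continuous_attains_sup[OF compact_sphere ne V] by blast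
  moreover have "V \<theta>0 > 0"
    using assms \<theta>0(1) by (simp add: sphere_solution_def)
  ultimately show ?thesis
    using \<theta>0 by (intro that[of "V \<theta>0" "V \<theta>1"]) auto
qed

lemma P0_solution_separated:
  fixes V :: "'a::euclidean_space \<Rightarrow> real" and \<gamma> q l :: real
  assumes sol: "sphere_solution (\<gamma> * (real DIM('a) - 2 - \<gamma>)) q V"
    and \<gamma>: "\<gamma> > 0" "l + \<gamma> * q = \<gamma> + 2"
  shows "P0_solution (\<lambda>r s. r powr (- l) * s powr q)
           (\<lambda>x. norm x powr (- \<gamma>) * V (x /\<^sub>R norm x))"
    (is "P0_solution _ ?u")
proof -
  let ?S = "UNIV - {0 :: 'a}"
  have nrm: "x /\<^sub>R norm x \<in> unit_sphere" if "x \<noteq> 0" for x :: 'a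
    using that by simp
  obtain U W where U: "unit_sphere \<subseteq> U" "C2_on U W"
    and W: "\<And>\<theta>. \<theta> \<in> unit_sphere \<Longrightarrow> W \<theta> = V \<theta>"
    using sol unfolding sphere_solution_def C2_sphere_def by blast
  \<comment> \<open>The factor is written as a power of the norm so that
    \<open>C2_map_norm_powr\<close> gives its regularity. Composition uses \<open>W\<close>, since
    only \<open>W\<close> is known to be C2 on an open set.\<close>
  define F where "F x = W (norm x powr (- 1) *\<^sub>R x)" for x
  have Fn: "F x = V (x /\<^sub>R norm x)" if "x \<noteq> 0" for x
    using W[OF nrm[OF that]] by (simp add: F_def powr_minus)
  have FC: "C2_map ?S F"
    unfolding F_def[abs_def]
  proof (rule C2_map_compose[of U W ?S "\<lambda>x. norm x powr (- 1) *\<^sub>R x"])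
    show "C2_map U W"
      using U(2) by (simp add: C2_on_iff_C2_map)
    show "C2_map ?S (\<lambda>x. norm x powr (- 1) *\<^sub>R x)"
      by (rule bounded_bilinear.C2_map[OF bounded_bilinear_scaleR C2_map_norm_powr
            C2_map_linear[OF bounded_linear_ident]])
    show "(\<lambda>x. norm x powr (- 1) *\<^sub>R x) ` ?S \<subseteq> U"
    proof (rule image_subsetI)
      fix x assume "x \<in> ?S"
      then show "norm x powr (- 1) *\<^sub>R x \<in> U"
        using U(1) nrm[of x] by (auto simp: powr_minus)
    qed
  qed
  \<comment> \<open>At the origin both sides are 0 because \<open>0 powr p = 0\<close>. Equality
    therefore holds everywhere and permits rewriting under the binder.\<close>
  have eq: "norm x powr (- \<gamma>) * F x = ?u x" for x
    using Fn by (cases "x = 0") auto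
  have C2: "C2_on ?S ?u"
    using bounded_bilinear.C2_map[OF bounded_bilinear_mult C2_map_norm_powr FC, of "- \<gamma>"]
    by (simp add: C2_on_iff_C2_map eq)
  obtain F' F'' where F': "\<And>x. x \<noteq> 0 \<Longrightarrow> (F has_derivative blinfun_apply (F' x)) (at x)"
    and F'': "\<And>x. x \<noteq> 0 \<Longrightarrow> (F' has_derivative blinfun_apply (F'' x)) (at x)"
    using FC unfolding C2_map_def C1_map_def by blast
  have hom: "F (t *\<^sub>R x) = F x" if "x \<noteq> 0" "t > 0" for x t
  proof -
    have "norm (t *\<^sub>R x) powr (- 1) * t = norm x powr (- 1)"
      using that by (simp add: powr_minus field_simps)
    then show ?thesis
      by (simp only: F_def scaleR_scaleR)
  qed
  have VF: "V \<theta> = F \<theta>" if "\<theta> \<in> unit_sphere" for \<theta>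
    using Fn[of \<theta>] that by (cases "\<theta> = 0") auto
  have pde: "- laplacian ?u x = norm x powr (- l) * ?u x powr q \<and> ?u x > 0" if x: "x \<noteq> 0" for x
  proof -
    let ?\<theta> = "x /\<^sub>R norm x"
    have V: "- laplace_beltrami V ?\<theta> + \<gamma> * (real DIM('a) - 2 - \<gamma>) * V ?\<theta> = V ?\<theta> powr q" "V ?\<theta> > 0"
      using sol nrm[OF x] by (auto simp: sphere_solution_def)
    have "- laplacian ?u x = norm x powr (- \<gamma> - 2) *
        (- laplace_beltrami V ?\<theta> + \<gamma> * (real DIM('a) - 2 - \<gamma>) * V ?\<theta>)"
      using laplacian_norm_powr_hom0[of F F' F'' x V \<gamma>, OF hom F' F'' x VF, unfolded eq]
      by (simp add: algebra_simps)
    also have "\<dots> = norm x powr (- l + - \<gamma> * q) * V ?\<theta> powr q"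
    proof -
      \<comment> \<open>This is where the choice of \<gamma> matters: the factor left by the
        Laplacian matches the weight times the \<open>q\<close>-th power of the radial
        factor.\<close>
      have "- \<gamma> - 2 = - l + - \<gamma> * q"
        using \<gamma>(2) by simp
      then show ?thesis
        by (simp only: V(1))
    qed
    also have "\<dots> = norm x powr (- l) * ?u x powr q"
      using V(2) unfolding powr_add by (simp add: powr_mult powr_powr)
    finally show ?thesis
      using V(2) x by simp
  qed
  obtain m M where m: "m > 0"
    and mM: "\<And>\<theta>. \<theta> \<in> unit_sphere \<Longrightarrow> m \<le> V \<theta> \<and> V \<theta> \<le> M"
    using sphere_solution_bounds[OF sol] by blast
  have bounds: "norm x powr (- \<gamma>) * m \<le> ?u x" "?u x \<le> norm x powr (- \<gamma>) * M" if "x \<noteq> 0" for x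
    using mM[OF nrm[OF that]] by (auto intro!: mult_left_mono)
  have "(?u \<longlongrightarrow> 0) at_infinity"
  proof (rule tendsto_sandwich)
    have nz: "\<forall>\<^sub>F x in at_infinity. (x::'a) \<noteq> 0"
      by (auto simp: eventually_at_infinity intro!: exI[of _ 1])
    show "\<forall>\<^sub>F x in at_infinity. 0 \<le> ?u x"
      using nz by eventually_elim (use pde in \<open>simp add: less_imp_le\<close>)
    show "\<forall>\<^sub>F x in at_infinity. ?u x \<le> norm x powr (- \<gamma>) * M"
      using nz by eventually_elim (use bounds in simp)
    show "((\<lambda>x::'a. norm x powr (- \<gamma>) * M) \<longlongrightarrow> 0) at_infinity"
      using \<gamma>(1) by (intro tendsto_mult_left_zero tendsto_neg_powr filterlim_norm_at_top) auto
  qed simp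
  moreover have "filterlim ?u at_top (at 0)"
  proof (rule filterlim_at_top_mono)
    have "filterlim (\<lambda>t::real. t powr (- \<gamma>)) at_top (at_right 0)"
      using \<gamma>(1) by real_asymp
    moreover have "filterlim norm (at_right 0) (at (0::'a))"
      unfolding filterlim_at by (auto intro!: tendsto_eq_intros simp: eventually_at_filter)
    ultimately have "filterlim (\<lambda>x::'a. norm x powr (- \<gamma>)) at_top (at 0)"
      by (rule filterlim_compose)
    then show "filterlim (\<lambda>x::'a. norm x powr (- \<gamma>) * m) at_top (at 0)"
      using m by (intro filterlim_at_top_mult_tendsto_pos[OF tendsto_const])
    show "\<forall>\<^sub>F x in at 0. norm x powr (- \<gamma>) * m \<le> ?u x"
      using bounds by (auto simp: eventually_at_filter)
  qed
  ultimately show ?thesis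
    unfolding P0_solution_def using C2 pde by blast
qed

text \<open>On the unit sphere \<open>u\<close> coincides with \<open>V\<close>, and a radial
  function is constant there.\<close>

lemma not_radial_separated:
  assumes "\<not> V constant_on unit_sphere"
    and u: "\<And>x. x \<noteq> 0 \<Longrightarrow> u x = norm x powr p * V (x /\<^sub>R norm x)"
  shows "\<not> radial u"
proof
  assume "radial u"
  then obtain g where g: "\<And>x. x \<noteq> 0 \<Longrightarrow> u x = g (norm x)"
    unfolding radial_def by blast
  have "V \<theta> = g 1" if "\<theta> \<in> unit_sphere" for \<theta>
    using u[of \<theta>] g[of \<theta>] that by (cases "\<theta> = 0") auto
  with assms(1) show False
    unfolding constant_on_def by blast
qed

text \<open>Put \<open>t = (N - 2) / 2 - \<gamma>\<close>. Then \<open>\<gamma> (N - 2 - \<gamma>) = ((N - 2) / 2)\<^sup>2 - t\<^sup>2\<close>, and the bounds on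
  \<open>l\<close> say that \<open>t\<close> lies between the two square roots.\<close>

lemma exponent_bounds:
  fixes N q e l :: real
  assumes "N > 3" and q: "q > (N + 1) / (N - 3)"
    and e: "(N - 1) / (q - 1) - e > 0"
    and l_lower: "2 - (N - 2) * (q - 1) / 2
          + (q - 1) * sqrt (((N - 2) / 2)\<^sup>2 - (N - 1) / (q - 1)) < l"
    and l_upper: "l < 2 - (N - 2) * (q - 1) / 2
          + (q - 1) * sqrt (((N - 2) / 2)\<^sup>2 - (N - 1) / (q - 1) + e)"
  defines "\<gamma> \<equiv> (2 - l) / (q - 1)"
  shows "\<gamma> > 0" "l + \<gamma> * q = \<gamma> + 2"
    "(N - 1) / (q - 1) - e < \<gamma> * (N - 2 - \<gamma>)" "\<gamma> * (N - 2 - \<gamma>) < (N - 1) / (q - 1)"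
proof -
  have q1: "q - 1 > 4 / (N - 3)"
    using q \<open>N > 3\<close> by (simp add: field_simps)
  then have q0: "q - 1 > 0"
    using \<open>N > 3\<close> by (smt (verit) divide_pos_pos)
  define A where "A = ((N - 2) / 2)\<^sup>2"
  define B where "B = (N - 1) / (q - 1)"
  define t where "t = (N - 2) / 2 - \<gamma>"
  \<comment> \<open>The lower bound on \<open>q\<close> amounts to
    \<open>4 / (q - 1) < N - 3\<close>. Hence \<open>B\<close> is at most \<open>A - 1 / 4\<close>,
    and the smaller square root is positive.\<close>
  have "B * 4 \<le> (N - 1) * (N - 3)"
  proof -
    have "4 / (q - 1) \<le> N - 3"
      using q1 q0 \<open>N > 3\<close> by (simp add: field_simps)
    then have "(N - 1) * (4 / (q - 1)) \<le> (N - 1) * (N - 3)"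
      using \<open>N > 3\<close> by (intro mult_left_mono) auto
    then show ?thesis
      by (simp add: B_def mult.commute)
  qed
  moreover have "4 * A = (N - 1) * (N - 3) + 1"
    by (simp add: A_def power2_eq_square field_simps)
  ultimately have AB: "A - B > 0"
    by linarith
  have l: "l = 2 - \<gamma> * (q - 1)"
    using q0 by (simp add: \<gamma>_def)
  have "(q - 1) * sqrt (A - B) < (q - 1) * t"
    using l_lower unfolding l t_def by (simp add: A_def B_def algebra_simps)
  then have t1: "sqrt (A - B) < t"
    using q0 by simp
  have "(q - 1) * t < (q - 1) * sqrt (A - B + e)"
    using l_upper unfolding l t_def by (simp add: A_def B_def algebra_simps)
  then have t2: "t < sqrt (A - B + e)"
    using q0 by simp
  have t0: "t > 0"
    using t1 AB by (smt (verit) real_sqrt_gt_zero)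
  have a: "\<gamma> * (N - 2 - \<gamma>) = A - t\<^sup>2"
    by (simp add: A_def t_def power2_eq_square field_simps)
  \<comment> \<open>Since \<open>t\<close> is positive, the bounds on \<open>t\<close> become bounds
    on \<open>t\<^sup>2\<close>; \<open>sqrt\<close> is strictly increasing on all reals, so the
    radicands need no sign check.\<close>
  have "sqrt (t\<^sup>2) = t"
    using t0 by simp
  then have "sqrt (A - B) < sqrt (t\<^sup>2)" "sqrt (t\<^sup>2) < sqrt (A - B + e)"
    using t1 t2 by simp_all
  then have t_sq: "A - B < t\<^sup>2" "t\<^sup>2 < A - B + e"
    by (simp_all only: real_sqrt_less_iff)
  then show "\<gamma> * (N - 2 - \<gamma>) < (N - 1) / (q - 1)"
    unfolding a B_def[symmetric] by linarith
  show *: "(N - 1) / (q - 1) - e < \<gamma> * (N - 2 - \<gamma>)"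
    using t_sq unfolding a B_def[symmetric] by linarith
  \<comment> \<open>Here \<open>(N - 2) / 2 + t\<close> is \<open>N - 2 - \<gamma>\<close>. Both it
    and its product with \<gamma> are positive, the product because it exceeds
    \<open>(N - 1) / (q - 1) - e\<close>.\<close>
  have "0 < \<gamma> * ((N - 2) / 2 + t)"
    using * e by (simp add: t_def)
  moreover have "(N - 2) / 2 + t > 0"
    using t0 \<open>N > 3\<close> by (simp add: add_pos_pos)
  ultimately show "\<gamma> > 0"
    by (rule zero_less_mult_pos2)
  show "l + \<gamma> * q = \<gamma> + 2"
    unfolding l by (simp add: algebra_simps)
qed

theorem lemma6p3:
  fixes N q \<epsilon>\<^sub>0 l :: real
  assumes N: "N = real CARD('n::finite)" "CARD('n) \<ge> 4"
    and q: "q > (N + 1) / (N - 3)"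
    and eps: "\<epsilon>\<^sub>0 > 0" "(N - 1) / (q - 1) - \<epsilon>\<^sub>0 > 0"
    and brezis_li: "\<And>a. (N - 1) / (q - 1) - \<epsilon>\<^sub>0 < a \<Longrightarrow> a < (N - 1) / (q - 1) \<Longrightarrow>
          \<exists>V :: real ^ 'n \<Rightarrow> real. nonconstant_sphere_solution a q V"
    and l_lower: "2 - (N - 2) * (q - 1) / 2
          + (q - 1) * sqrt (((N - 2) / 2)\<^sup>2 - (N - 1) / (q - 1)) < l"
    and l_upper: "l < 2 - (N - 2) * (q - 1) / 2
          + (q - 1) * sqrt (((N - 2) / 2)\<^sup>2 - (N - 1) / (q - 1) + \<epsilon>\<^sub>0)"
  shows "let \<gamma> = (2 - l) / (q - 1) in
    \<exists>(u :: real ^ 'n \<Rightarrow> real) V.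
      P0_solution (\<lambda>r s. r powr (- l) * s powr q) u \<and> \<not> radial u \<and>
      nonconstant_sphere_solution (\<gamma> * (N - 2 - \<gamma>)) q V \<and>
      (\<forall>x. x \<noteq> 0 \<longrightarrow> u x = norm x powr (- \<gamma>) * V (x /\<^sub>R norm x))"
proof -
  define \<gamma> where "\<gamma> = (2 - l) / (q - 1)"
  have "N > 3"
    using N by simp
  note \<gamma> = exponent_bounds[OF this q eps(2) l_lower l_upper, folded \<gamma>_def]
  \<comment> \<open>The bounds on \<open>l\<close> place
    \<open>\<gamma> * (N - 2 - \<gamma>)\<close> in the interval where non-constant solutions on the
    sphere are available.\<close>
  obtain V :: "real ^ 'n \<Rightarrow> real" where V: "nonconstant_sphere_solution (\<gamma> * (N - 2 - \<gamma>)) q V"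
    using brezis_li \<gamma>(3,4) by blast
  define u where "u x = norm x powr (- \<gamma>) * V (x /\<^sub>R norm x)" for x
  have "P0_solution (\<lambda>r s. r powr (- l) * s powr q) u"
    using P0_solution_separated[OF _ \<gamma>(1,2), of V] V
    by (simp add: u_def[abs_def] nonconstant_sphere_solution_def N(1))
  moreover have "\<not> radial u"
    using V not_radial_separated[of V u "- \<gamma>"]
    by (simp add: u_def nonconstant_sphere_solution_def)
  ultimately show ?thesis
    unfolding Let_def \<gamma>_def[symmetric] using V
    by (intro exI[of _ u] exI[of _ V] conjI) (simp_all add: u_def)
qed

end
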